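(* Let $\Lambda(z)=\lambda_2z^2+\lambda_3z^3+\cdots$ be a formal power series with coefficients in a field of characteristic $0$, where $\lambda_2\ne0$. Then the equation \[H=t+k\Lambda(H)\] has a unique formal power series solution $H(t,k)=t+\lambda_2kt^2+(\lambda_3k+2\lambda_2^2k^2)t^3+\cdots$, in which the coefficient of $t^n$ is a polynomial in $k$ of degree $n-1$. Let $\mu_l(n)/n!$ be the coefficient of $k^{n-l}t^n$ in $H(t,k)$. Then for each $l$, $\sum_{n=0}^\infty\mu_l(n)t^n/n!$ is a Laurent polynomial in $\sqrt{1-4\lambda_2t}$ with no even negative powers. *)

theory Defs
  imports "HOL-Computational_Algebra.Computational_Algebra"
begin

text \<open>
  A bivariate formal power series in \<open>t\<close> and \<open>k\<close> is represented as an element \<open>H\<close> of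
  \<^typ>\<open>'a fps fps\<close>: the outer variable is \<open>t\<close>, the inner one is \<open>k\<close>, so that
  \<open>H $ n $ j\<close> is the coefficient of \<open>k\<^sup>j t\<^sup>n\<close>.
\<close>

abbreviation t_var :: "'a::field_char_0 fps fps" where
  "t_var \<equiv> fps_X"

abbreviation k_var :: "'a::field_char_0 fps fps" where
  "k_var \<equiv> fps_const fps_X"

text \<open>
  Substitution of a bivariate series \<open>H\<close> with \<open>H $ 0 $ 0 = 0\<close> into a univariate one,
  \<open>L(H) = \<Sum>\<^sub>i L\<^sub>i H\<^sup>i\<close>.  Since \<open>H ^ i\<close> has no terms of total degree below \<open>i\<close>,
  only the indices \<open>i \<le> n + j\<close> contribute to the coefficient of \<open>k\<^sup>j t\<^sup>n\<close>.
  The library composition \<^const>\<open>fps_compose\<close> is not used directly because it would require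
  the stronger condition \<open>H $ 0 = 0\<close>, i.e. \<open>H(0,k) = 0\<close>; under that condition the two agree
  (lemma \<open>subst2_eq_fps_compose\<close>).
\<close>

definition subst2 :: "'a::field_char_0 fps \<Rightarrow> 'a fps fps \<Rightarrow> 'a fps fps" where
  "subst2 L H = Abs_fps (\<lambda>n. Abs_fps (\<lambda>j. \<Sum>i\<le>n + j. L $ i * (H ^ i) $ n $ j))"

lemma subst2_nth: "subst2 L H $ n $ j = (\<Sum>i\<le>n + j. L $ i * (H ^ i) $ n $ j)"
  by (simp add: subst2_def)

lemma power_nth_nth_eq_0:
  fixes H :: "'a::field_char_0 fps fps"
  assumes "H $ 0 $ 0 = 0" "n + j < i"
  shows "(H ^ i) $ n $ j = 0"
  using assms(2)
proof (induction i arbitrary: n j)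
  case (Suc i)
  have "H $ a $ b * (H ^ i) $ (n - a) $ (j - b) = 0" if "a \<le> n" "b \<le> j" for a b
  proof (cases "a = 0 \<and> b = 0")
    case False
    then have "(n - a) + (j - b) < i" using Suc.prems that by auto
    then show ?thesis using Suc.IH by simp
  qed (simp add: assms(1))
  then show ?case
    by (simp add: fps_mult_nth fps_sum_nth sum.neutral)
qed simp

lemma subst2_nth_ge:
  assumes "H $ 0 $ 0 = 0" "n + j \<le> N"
  shows "subst2 L H $ n $ j = (\<Sum>i\<le>N. L $ i * (H ^ i) $ n $ j)"
  unfolding subst2_nth
  by (rule sum.mono_neutral_left) (use assms in \<open>auto simp: power_nth_nth_eq_0\<close>)

lemma subst2_eq_fps_compose:
  assumes "H $ 0 = 0"
  shows "subst2 L H = Abs_fps (\<lambda>i. fps_const (L $ i)) oo H"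
proof (intro fps_ext)
  fix n j
  have "(H ^ i) $ n = 0" if "n < i" for i
    using startsby_zero_power_prefix[OF assms] that by blast
  then have "(\<Sum>i\<le>n + j. L $ i * (H ^ i) $ n $ j) = (\<Sum>i\<in>{0..n}. L $ i * (H ^ i) $ n $ j)"
    by (intro sum.mono_neutral_right) auto
  then show "subst2 L H $ n $ j = (Abs_fps (\<lambda>i. fps_const (L $ i)) oo H) $ n $ j"
    by (simp add: subst2_nth fps_compose_nth fps_sum_nth)
qed

definition is_solution :: "'a::field_char_0 fps \<Rightarrow> 'a fps fps \<Rightarrow> bool" where
  "is_solution L H \<longleftrightarrow> H $ 0 $ 0 = 0 \<and> H = t_var + k_var * subst2 L H"

text \<open>
  The index \<open>l\<close> is an integer, and coefficients of negative powers of \<open>k\<close> are zero.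
\<close>

definition mu :: "'a::field_char_0 fps fps \<Rightarrow> int \<Rightarrow> nat \<Rightarrow> 'a" where
  "mu H l n = fact n * (if l \<le> int n then H $ n $ nat (int n - l) else 0)"

text \<open>
  The square root of \<open>1 - 4ct\<close> is the formal power series in \<open>t\<close> with constant term 1; the first
  argument of \<^const>\<open>fps_radical\<close> supplies the root of the constant term \<open>1\<close>.
\<close>

definition sqrt_1_minus_4 :: "'a::field_char_0 \<Rightarrow> 'a fps" where
  "sqrt_1_minus_4 c = fps_radical (\<lambda>_ _. 1) 2 (1 - fps_const (4 * c) * fps_X)"

lemma sqrt_1_minus_4_nth_0: "sqrt_1_minus_4 c $ 0 = 1"
  by (simp add: sqrt_1_minus_4_def)

lemma sqrt_1_minus_4_power2: "sqrt_1_minus_4 c ^ 2 = 1 - fps_const (4 * c) * fps_X"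
  using power_radical[of "1 - fps_const (4 * c) * fps_X" "\<lambda>_ _. 1" 1]
  by (simp add: sqrt_1_minus_4_def numeral_2_eq_2)

text \<open>
  \<open>F\<close> is a Laurent polynomial \<open>\<Sum>\<^sub>j c\<^sub>j S\<^sup>j\<close> in \<open>S\<close>, with \<open>c\<^sub>j = 0\<close> for all even \<open>j < 0\<close>.
  It is meant for series \<open>S\<close> with nonzero constant term, so that negative powers make sense.
\<close>

definition laurent_poly_no_even_neg :: "'a::field_char_0 fps \<Rightarrow> 'a fps \<Rightarrow> bool" where
  "laurent_poly_no_even_neg S F \<longleftrightarrow>
     (\<exists>c :: int \<Rightarrow> 'a. finite {j. c j \<noteq> 0} \<and> (\<forall>j<0. even j \<longrightarrow> c j = 0) \<and>
        F = (\<Sum>j | c j \<noteq> 0. fps_const (c j) * S powi j))"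

end

theory Submission
  imports Defs
begin

text \<open>
  Existence and uniqueness hold because the coefficient of \<open>k\<^sup>a\<close> on the right-hand side
  involves only coefficients of \<open>H\<close> at lower powers of \<open>k\<close>.  For the last claim let
  \<open>F\<^sub>j\<^sub>,\<^sub>m(t) = \<Sum>\<^sub>n [k\<^bsup>n-j-m\<^esup> t\<^sup>n] H\<^sup>j \<cdot> t\<^sup>n\<close>; the series in
  question are \<open>F\<^sub>1\<^sub>,\<^sub>m\<close> with \<open>m = l - 1\<close>.  The functional equation gives
  \<open>(t \<partial>\<^sub>t - k \<partial>\<^sub>k - j) H\<^sup>j = \<partial>\<^sub>t (k \<Sum>\<^sub>i (i - 2) \<lambda>\<^sub>i j / (i + j) H\<^bsup>i+j\<^esup>)\<close>,
  whose coefficients read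
  \<open>m F\<^sub>j\<^sub>,\<^sub>m = d/dt \<Sum>\<^sub>i (i - 2) \<lambda>\<^sub>i j / (i + j) F\<^bsub>i+j, m+2-i\<^esub>\<close> with \<open>3 \<le> i \<le> m + 2\<close>.
  Moreover \<open>F\<^sub>j\<^sub>,\<^sub>0 = ((1 - S) / (2 \<lambda>\<^sub>2))\<^sup>j\<close> with \<open>S\<close> the square root of \<open>1 - 4 \<lambda>\<^sub>2 t\<close>.
  Since \<open>dS\<^sup>j/dt = -2 \<lambda>\<^sub>2 j S\<^bsup>j-2\<^esup>\<close> vanishes for \<open>j = 0\<close>, differentiation never creates
  an even negative power of \<open>S\<close>, and induction on \<open>m\<close> finishes the proof.
\<close>

subsection \<open>Laurent polynomials without even negative powers\<close>

text \<open>The definition sums over the exact support of the coefficients. Allowing any finite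
  index set lets the closure proofs work on a union of supports or with coefficients that may
  vanish.\<close>

lemma laurent_poly_no_even_neg_sum:
  fixes S :: "'a::field_char_0 fps"
  assumes "finite A" "\<And>j. j \<in> A \<Longrightarrow> j < 0 \<Longrightarrow> odd j"
  shows "laurent_poly_no_even_neg S (\<Sum>j\<in>A. fps_const (c j) * S powi j)"
proof -
  define c' where "c' j = (if j \<in> A then c j else 0)" for j
  have sub: "{j. c' j \<noteq> 0} \<subseteq> A" by (auto simp: c'_def)
  have "(\<Sum>j\<in>A. fps_const (c j) * S powi j) = (\<Sum>j\<in>A. fps_const (c' j) * S powi j)"
    by (simp add: c'_def)
  also have "\<dots> = (\<Sum>j | c' j \<noteq> 0. fps_const (c' j) * S powi j)"
    by (rule sum.mono_neutral_right) (use assms(1) sub in auto)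
  finally show ?thesis
    unfolding laurent_poly_no_even_neg_def
    using assms sub by (intro exI[of _ c']) (auto intro: finite_subset simp: c'_def)
qed

lemma laurent_poly_no_even_neg_monomial:
  "(j < 0 \<Longrightarrow> odd j) \<Longrightarrow> laurent_poly_no_even_neg S (fps_const b * S powi j)"
  using laurent_poly_no_even_neg_sum[of "{j}" S "\<lambda>_. b"] by simp

lemma laurent_poly_no_even_neg_0: "laurent_poly_no_even_neg S 0"
  using laurent_poly_no_even_neg_sum[of "{}" S] by simp

lemma laurent_poly_no_even_neg_add:
  assumes "laurent_poly_no_even_neg S F" "laurent_poly_no_even_neg S G"
  shows "laurent_poly_no_even_neg S (F + G)"
proof -
  obtain c where c: "finite {j. c j \<noteq> 0}" "\<And>j. j < 0 \<Longrightarrow> even j \<Longrightarrow> c j = 0"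
      "F = (\<Sum>j | c j \<noteq> 0. fps_const (c j) * S powi j)"
    using assms(1) unfolding laurent_poly_no_even_neg_def by blast
  obtain d where d: "finite {j. d j \<noteq> 0}" "\<And>j. j < 0 \<Longrightarrow> even j \<Longrightarrow> d j = 0"
      "G = (\<Sum>j | d j \<noteq> 0. fps_const (d j) * S powi j)"
    using assms(2) unfolding laurent_poly_no_even_neg_def by blast
  let ?A = "{j. c j \<noteq> 0} \<union> {j. d j \<noteq> 0}"
  have "F = (\<Sum>j\<in>?A. fps_const (c j) * S powi j)"
    unfolding c(3) by (rule sum.mono_neutral_left) (use c d in auto)
  moreover have "G = (\<Sum>j\<in>?A. fps_const (d j) * S powi j)"
    unfolding d(3) by (rule sum.mono_neutral_left) (use c d in auto)
  ultimately have "F + G = (\<Sum>j\<in>?A. fps_const (c j + d j) * S powi j)"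
    by (simp add: sum.distrib[symmetric] distrib_right flip: fps_const_add)
  then show ?thesis
    using laurent_poly_no_even_neg_sum[of ?A S "\<lambda>j. c j + d j"] c d by auto
qed

lemma laurent_poly_no_even_neg_closed_sum:
  "(\<And>i. i \<in> I \<Longrightarrow> laurent_poly_no_even_neg S (F i)) \<Longrightarrow> laurent_poly_no_even_neg S (\<Sum>i\<in>I. F i)"
  by (induction I rule: infinite_finite_induct)
    (auto intro: laurent_poly_no_even_neg_add laurent_poly_no_even_neg_0)

lemma laurent_poly_no_even_neg_cmult:
  assumes "laurent_poly_no_even_neg S F"
  shows "laurent_poly_no_even_neg S (fps_const b * F)"
proof -
  obtain c where c: "finite {j. c j \<noteq> 0}" "\<And>j. j < 0 \<Longrightarrow> even j \<Longrightarrow> c j = 0"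
      "F = (\<Sum>j | c j \<noteq> 0. fps_const (c j) * S powi j)"
    using assms unfolding laurent_poly_no_even_neg_def by blast
  have "fps_const b * F = (\<Sum>j | c j \<noteq> 0. fps_const (b * c j) * S powi j)"
    by (simp add: c(3) sum_distrib_left mult.assoc flip: fps_const_mult)
  then show ?thesis
    using laurent_poly_no_even_neg_sum[of "{j. c j \<noteq> 0}" S "\<lambda>j. b * c j"] c by auto
qed

lemma laurent_poly_no_even_neg_power:
  "laurent_poly_no_even_neg S (S ^ n)"
  using laurent_poly_no_even_neg_monomial[of "int n" S 1] by simp

text \<open>Binomial expansion yields only nonnegative powers of \<open>S\<close>. This is the base
  case \<open>m = 0\<close> of the final induction.\<close>

lemma laurent_poly_no_even_neg_linear_power:
  "laurent_poly_no_even_neg S ((fps_const a + fps_const b * S) ^ n)"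
  unfolding binomial_ring
proof (rule laurent_poly_no_even_neg_closed_sum)
  fix k
  have "of_nat (n choose k) * fps_const a ^ k * (fps_const b * S) ^ (n - k)
      = fps_const (of_nat (n choose k) * a ^ k * b ^ (n - k)) * S ^ (n - k)"
    by (simp add: power_mult_distrib fps_of_nat[symmetric] mult.assoc)
  then show "laurent_poly_no_even_neg S
      (of_nat (n choose k) * fps_const a ^ k * (fps_const b * S) ^ (n - k))"
    using laurent_poly_no_even_neg_cmult[OF laurent_poly_no_even_neg_power] by metis
qed

subsection \<open>The square root of \<open>1 - 4ct\<close>\<close>

lemma sqrt_1_minus_4_deriv:
  "sqrt_1_minus_4 c * fps_deriv (sqrt_1_minus_4 c) = fps_const (-2 * c)"
proof -
  have "fps_deriv (sqrt_1_minus_4 c ^ 2) = fps_const (- 4 * c)"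
    unfolding sqrt_1_minus_4_power2 by simp
  moreover have "fps_deriv (sqrt_1_minus_4 c ^ 2)
      = fps_const 2 * (sqrt_1_minus_4 c * fps_deriv (sqrt_1_minus_4 c))"
    by (simp add: fps_deriv_power mult_ac)
  ultimately have "fps_const (1/2) * (fps_const 2 * (sqrt_1_minus_4 c * fps_deriv (sqrt_1_minus_4 c)))
     = fps_const (1/2) * fps_const (- 4 * c)" by simp
  then show ?thesis by (simp flip: mult.assoc)
qed

lemma sqrt_1_minus_4_deriv':
  "fps_deriv (sqrt_1_minus_4 c) = fps_const (-2 * c) * inverse (sqrt_1_minus_4 c)"
proof -
  have "sqrt_1_minus_4 c * inverse (sqrt_1_minus_4 c) = 1"
    by (rule inverse_mult_eq_1') (simp add: sqrt_1_minus_4_nth_0)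
  then show ?thesis
    by (metis sqrt_1_minus_4_deriv mult.assoc mult.commute mult.right_neutral)
qed

text \<open>Multiplying \<open>S * S' = -2c\<close> by \<open>S\<close> gives
  \<open>(1 - 4ct) S' = -2c S\<close>, hence \<open>(n+1) s_(n+1) = 2c (2n-1) s_n\<close>. The
  factor \<open>2n-1\<close> is nonzero by parity in characteristic 0. Needed for the exact degree
  in \<open>k\<close>.\<close>

lemma sqrt_1_minus_4_nth_nonzero:
  assumes "(c::'a::field_char_0) \<noteq> 0"
  shows "sqrt_1_minus_4 c $ n \<noteq> 0"
proof (induction n)
  case 0
  then show ?case by (simp add: sqrt_1_minus_4_nth_0)
next
  case (Suc n)
  let ?S = "sqrt_1_minus_4 c"
  have "(1 - fps_const (4 * c) * fps_X) * fps_deriv ?S = fps_const (-2 * c) * ?S"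
    using sqrt_1_minus_4_deriv[of c] unfolding sqrt_1_minus_4_power2[symmetric]
    by (simp add: power2_eq_square mult_ac)
  then have "((1 - fps_const (4 * c) * fps_X) * fps_deriv ?S) $ n = (fps_const (-2 * c) * ?S) $ n"
    by simp
  then have "of_nat (Suc n) * ?S $ Suc n - 4 * c * (of_nat n * ?S $ n) = -2 * c * ?S $ n"
    by (cases n) (simp_all add: algebra_simps)
  then have "of_nat (Suc n) * ?S $ Suc n = 2 * c * (2 * of_nat n - 1) * ?S $ n"
    by (simp add: algebra_simps)
  moreover have "(2 * of_nat n - 1 :: 'a) \<noteq> 0"
  proof
    assume "(2 * of_nat n - 1 :: 'a) = 0"
    then have "(of_nat (2 * n) :: 'a) = of_nat 1" by simp
    then show False unfolding of_nat_eq_iff by presburger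
  qed
  ultimately show ?case using Suc assms by auto
qed

text \<open>The derivative of \<open>S^j\<close> is \<open>-2cj S^(j-2)\<close>. The exponent
  \<open>j - 2\<close> is negative only for \<open>j = 1\<close>, for \<open>j = 0\<close>, where
  the factor \<open>j\<close> vanishes, and for \<open>j < 0\<close>, where \<open>j\<close> is
  odd.\<close>

lemma laurent_poly_no_even_neg_deriv:
  assumes "laurent_poly_no_even_neg (sqrt_1_minus_4 c) F"
  shows "laurent_poly_no_even_neg (sqrt_1_minus_4 c) (fps_deriv F)"
proof -
  let ?S = "sqrt_1_minus_4 c" and ?R = "inverse (sqrt_1_minus_4 c)"
  obtain d where d: "finite {j. d j \<noteq> 0}" "\<And>j. j < 0 \<Longrightarrow> even j \<Longrightarrow> d j = 0"
      "F = (\<Sum>j | d j \<noteq> 0. fps_const (d j) * ?S powi j)"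
    using assms unfolding laurent_poly_no_even_neg_def by blast
  have SR: "?S * ?R = 1"
    by (rule inverse_mult_eq_1') (simp add: sqrt_1_minus_4_nth_0)
  have monomial: "laurent_poly_no_even_neg ?S (fps_deriv (?S powi j))" if "j < 0 \<Longrightarrow> odd j" for j
  proof -
    consider (zero) "j = 0" | (one) "j = 1" | (pos) n where "j = int (Suc (Suc n))"
      | (neg) n where "j = - int (Suc n)"
      by (metis (no_types) int_cases nat.exhaust of_nat_0 of_nat_1 One_nat_def)
    then show ?thesis
    proof cases
      case zero
      then show ?thesis by (simp add: laurent_poly_no_even_neg_0)
    next
      case one
      then show ?thesis
        using laurent_poly_no_even_neg_monomial[of "-1" ?S "-2 * c"]
        by (simp add: sqrt_1_minus_4_deriv' power_int_minus)
    next
      case pos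
      have "fps_deriv (?S powi j) = fps_const (of_nat (Suc (Suc n))) * fps_deriv ?S * ?S ^ Suc n"
        unfolding pos power_int_of_nat fps_deriv_power by simp
      also have "\<dots> = fps_const (of_nat (Suc (Suc n))) * fps_const (-2 * c) * ?S ^ n * (?S * ?R)"
        unfolding sqrt_1_minus_4_deriv' by (simp only: mult_ac power_Suc)
      also have "\<dots> = fps_const (of_nat (Suc (Suc n)) * (-2 * c)) * ?S ^ n"
        unfolding SR by simp
      finally show ?thesis
        by (metis laurent_poly_no_even_neg_cmult laurent_poly_no_even_neg_power)
    next
      case neg
      \<comment> \<open>Here \<open>j = -(n+1)\<close> is odd, so the exponent \<open>-(n+3)\<close>
        reached below is odd as well.\<close>
      have "even n" using that neg by auto
      have R': "fps_deriv ?R = fps_const (2 * c) * ?R ^ 3"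
      proof -
        have "fps_deriv ?R = - fps_deriv ?S * ?R ^ 2"
          by (rule fps_inverse_deriv) (simp add: sqrt_1_minus_4_nth_0)
        then show ?thesis unfolding sqrt_1_minus_4_deriv'
          by (simp add: power2_eq_square power3_eq_cube mult_ac flip: fps_const_neg)
      qed
      have pw: "?S powi (- int m) = ?R ^ m" for m
        by (cases m) (simp_all add: power_int_def nat_add_distrib nat_minus_as_int)
      have "fps_deriv (?S powi j) = fps_const (of_nat (Suc n)) * fps_deriv ?R * ?R ^ n"
        unfolding neg pw fps_deriv_power by simp
      also have "\<dots> = fps_const (of_nat (Suc n) * (2 * c)) * ?R ^ (n + 3)"
        unfolding R' by (simp add: power_add power3_eq_cube mult_ac flip: fps_const_mult)
      also have "\<dots> = fps_const (of_nat (Suc n) * (2 * c)) * ?S powi (- int (n + 3))"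
        unfolding pw ..
      finally show ?thesis
        using laurent_poly_no_even_neg_monomial[of "- int (n + 3)" ?S "of_nat (Suc n) * (2 * c)"] \<open>even n\<close>
        by simp
    qed
  qed
  have "fps_deriv F = (\<Sum>j | d j \<noteq> 0. fps_const (d j) * fps_deriv (?S powi j))"
    by (simp add: d(3) fps_deriv_sum)
  then show ?thesis
    using d(2) by (auto intro!: laurent_poly_no_even_neg_closed_sum laurent_poly_no_even_neg_cmult monomial)
qed

subsection \<open>Weights of bivariate series\<close>

lemma fps_fps_mult_nth_nth:
  fixes A B :: "'a::field_char_0 fps fps"
  shows "(A * B) $ n $ a = (\<Sum>i=0..n. \<Sum>b=0..a. A $ i $ b * B $ (n - i) $ (a - b))"
  by (simp add: fps_mult_nth fps_sum_nth)

text \<open>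
  The cutoff \<open>N\<close> on the exponent of \<open>k\<close> serves to prove \<open>weight_ge N 1 H\<close> for a solution
  by induction on \<open>N\<close>.
\<close>

definition weight_ge :: "nat \<Rightarrow> nat \<Rightarrow> 'a::field_char_0 fps fps \<Rightarrow> bool" where
  "weight_ge N d A \<longleftrightarrow> (\<forall>a\<le>N. \<forall>n<a + d. A $ n $ a = 0)"

lemma weight_geD: "weight_ge N d A \<Longrightarrow> a \<le> N \<Longrightarrow> n < a + d \<Longrightarrow> A $ n $ a = 0"
  by (simp add: weight_ge_def)

text \<open>If \<open>i \<ge> b + d\<close> and \<open>n - i \<ge> (a - b) + e\<close> both held,
  then \<open>n \<ge> a + d + e\<close>. So one factor of every product vanishes.\<close>

lemma weight_ge_mult:
  assumes "weight_ge N d A" "weight_ge N e B"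
  shows "weight_ge N (d + e) (A * B)"
  unfolding weight_ge_def fps_fps_mult_nth_nth
proof (intro allI impI sum.neutral ballI)
  fix a n i b assume H: "a \<le> N" "n < a + (d + e)" "i \<in> {0..n}" "b \<in> {0..a}"
  show "A $ i $ b * B $ (n - i) $ (a - b) = 0"
  proof (cases "i < b + d")
    case True
    then show ?thesis using weight_geD[OF assms(1), of b i] H by simp
  next
    case False
    then show ?thesis using weight_geD[OF assms(2), of "a - b" "n - i"] H by simp
  qed
qed

lemma weight_ge_power:
  assumes "weight_ge N 1 A"
  shows "weight_ge N i (A ^ i)"
proof (induction i)
  case 0
  show ?case by (auto simp: weight_ge_def)
next
  case (Suc i)
  then show ?case using weight_ge_mult[OF assms Suc] by simp
qed

text \<open>Collects the terms whose exponent of \<open>t\<close> exceeds that of \<open>k\<close>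
  by \<open>d\<close>. The series \<open>F_(j,m)\<close> is \<open>diagonal (j + m) (H ^ j)\<close>.
  The guard \<open>d \<le> n\<close> keeps truncated subtraction from producing spurious
  terms.\<close>

definition diagonal :: "nat \<Rightarrow> 'a::field_char_0 fps fps \<Rightarrow> 'a fps" where
  "diagonal d A = Abs_fps (\<lambda>n. if d \<le> n then A $ n $ (n - d) else 0)"

lemma diagonal_nth: "diagonal d A $ n = (if d \<le> n then A $ n $ (n - d) else 0)"
  by (simp add: diagonal_def)

text \<open>The weight bounds make \<open>d\<close> and \<open>e\<close> the lowest gaps between
  exponents, so a term of gap \<open>d + e\<close> in the product can only come from the lowest
  parts of both factors.\<close>

lemma diagonal_mult:
  assumes A: "\<And>N. weight_ge N d A" and B: "\<And>N. weight_ge N e B"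
  shows "diagonal (d + e) (A * B) = diagonal d A * diagonal e B"
proof (rule fps_ext)
  fix n
  show "diagonal (d + e) (A * B) $ n = (diagonal d A * diagonal e B) $ n"
  proof (cases "d + e \<le> n")
    case True
    have "(\<Sum>b=0..n - (d + e). A $ i $ b * B $ (n - i) $ (n - (d + e) - b))
        = diagonal d A $ i * diagonal e B $ (n - i)" (is "?L = ?R") if i: "i \<in> {0..n}" for i
    proof (cases "d \<le> i \<and> e \<le> n - i")
      case False
      then have "A $ i $ b * B $ (n - i) $ (n - (d + e) - b) = 0" for b
        using weight_geD[OF A, of b b i]
          weight_geD[OF B, of "n - (d + e) - b" "n - (d + e) - b" "n - i"] by fastforce
      then have "?L = 0" by (intro sum.neutral) blast
      then show ?thesis using False by (auto simp: diagonal_nth)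
    next
      case di: True
      \<comment> \<open>For \<open>b > i - d\<close> the weight of \<open>A\<close> kills the term,
        for \<open>b < i - d\<close> that of \<open>B\<close>.\<close>
      have "A $ i $ b * B $ (n - i) $ (n - (d + e) - b) = 0" if "b \<le> n - (d + e)" "b \<noteq> i - d" for b
      proof (cases "i < b + d")
        case True
        then show ?thesis using weight_geD[OF A, of b b i] by simp
      next
        case b: False
        then have "n - i < n - (d + e) - b + e" using that di i True by auto
        then show ?thesis by (simp add: weight_geD[OF B order_refl])
      qed
      then have "?L = (\<Sum>b\<in>{i - d}. A $ i $ b * B $ (n - i) $ (n - (d + e) - b))"
        using True di i by (intro sum.mono_neutral_right) auto
      also have "\<dots> = ?R"
        using di i True by (simp add: diagonal_nth) (metis add.commute)
      finally show ?thesis .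
    qed
    then show ?thesis using True
      by (simp add: diagonal_nth[of "d + e"] fps_fps_mult_nth_nth fps_mult_nth[of "diagonal d A"])
  next
    case False
    then have "(\<Sum>i=0..n. diagonal d A $ i * diagonal e B $ (n - i)) = 0"
      by (intro sum.neutral) (auto simp: diagonal_nth)
    with False show ?thesis by (simp add: diagonal_nth[of "d + e"] fps_mult_nth)
  qed
qed

lemma diagonal_power:
  assumes "\<And>N. weight_ge N 1 A"
  shows "diagonal i (A ^ i) = diagonal 1 A ^ i"
proof (induction i)
  case 0
  show ?case by (rule fps_ext) (simp add: diagonal_nth)
next
  case (Suc i)
  then show ?case
    using diagonal_mult[OF assms weight_ge_power[OF assms], of i] by simp
qed

subsection \<open>The operator \<open>t \<partial>\<^sub>t - k \<partial>\<^sub>k\<close>\<close>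

text \<open>Since \<open>k^a t^n\<close> is an eigenvector with eigenvalue \<open>n - a\<close>, the
  operator acts on each diagonal as a scalar, and the coefficientwise form makes this
  immediate.\<close>

definition euler_diff :: "'a::field_char_0 fps fps \<Rightarrow> 'a fps fps" where
  "euler_diff A = Abs_fps (\<lambda>n. Abs_fps (\<lambda>a. (of_nat n - of_nat a) * A $ n $ a))"

lemma euler_diff_nth: "euler_diff A $ n $ a = (of_nat n - of_nat a) * A $ n $ a"
  by (simp add: euler_diff_def)

lemma euler_diff_add: "euler_diff (A + B) = euler_diff A + euler_diff B"
  by (intro fps_ext) (simp add: euler_diff_nth algebra_simps)

lemma euler_diff_mult: "euler_diff (A * B) = euler_diff A * B + A * euler_diff B"
proof (intro fps_ext)
  fix n a
  \<comment> \<open>The eigenvalue is additive: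
    \<open>n - a = (i - b) + ((n - i) - (a - b))\<close>.\<close>
  have leibniz: "(of_nat n - of_nat a) * (A $ i $ b * B $ (n - i) $ (a - b))
     = euler_diff A $ i $ b * B $ (n - i) $ (a - b) + A $ i $ b * euler_diff B $ (n - i) $ (a - b)"
    if "i \<in> {0..n}" "b \<in> {0..a}" for i b
    using that by (simp add: euler_diff_nth of_nat_diff algebra_simps)
  then show "euler_diff (A * B) $ n $ a = (euler_diff A * B + A * euler_diff B) $ n $ a"
    unfolding euler_diff_nth[of "A * B"] fps_add_nth fps_fps_mult_nth_nth
    by (simp only: sum_distrib_left sum.distrib[symmetric] leibniz cong: sum.cong)
qed

lemma euler_diff_power:
  "euler_diff (A ^ Suc j) = of_nat (Suc j) * A ^ j * euler_diff A"
proof (induction j)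
  case 0
  show ?case by simp
next
  case (Suc j)
  have "euler_diff (A ^ Suc (Suc j)) = euler_diff A * A ^ Suc j + A * euler_diff (A ^ Suc j)"
    by (subst power_Suc) (rule euler_diff_mult)
  then show ?case unfolding Suc by (simp add: algebra_simps)
qed

lemma euler_diff_t_var: "euler_diff t_var = t_var"
  by (intro fps_ext) (simp add: euler_diff_nth)

lemma euler_diff_k_var: "euler_diff k_var = - k_var"
  by (intro fps_ext) (simp add: euler_diff_nth)

text \<open>As \<open>H ^ i\<close> starts at order \<open>i\<close>, one cutoff \<open>N\<close>
  serves all coefficients up to \<open>n\<close>, and the two finite sums can be swapped.\<close>

lemma compose_mult_nth:
  fixes A H X :: "'b::idom fps"
  assumes "H $ 0 = 0" "n \<le> N"
  shows "((A oo H) * X) $ n = (\<Sum>i\<le>N. A $ i * (H ^ i * X) $ n)"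
proof -
  have compose: "(A oo H) $ p = (\<Sum>i\<le>N. A $ i * (H ^ i) $ p)" if "p \<le> n" for p
    unfolding fps_compose_nth
    by (rule sum.mono_neutral_left)
      (use that assms startsby_zero_power_prefix[OF assms(1)] in \<open>auto simp: not_le\<close>)
  have "((A oo H) * X) $ n = (\<Sum>p=0..n. \<Sum>i\<le>N. A $ i * ((H ^ i) $ p * X $ (n - p)))"
    by (simp add: fps_mult_nth compose sum_distrib_right mult.assoc)
  also have "\<dots> = (\<Sum>i\<le>N. A $ i * (H ^ i * X) $ n)"
    by (subst sum.swap) (simp add: fps_mult_nth sum_distrib_left)
  finally show ?thesis .
qed

abbreviation const_coeffs :: "'a::field_char_0 fps \<Rightarrow> 'a fps fps" where
  "const_coeffs L \<equiv> Abs_fps (\<lambda>i. fps_const (L $ i))"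

text \<open>Chain rule: the operator is a derivation annihilating scalars, so the power rule applies
  term by term.\<close>

lemma euler_diff_compose:
  assumes "H $ 0 = 0"
  shows "euler_diff (const_coeffs L oo H) = (fps_deriv (const_coeffs L) oo H) * euler_diff H"
proof (intro fps_ext)
  fix n a
  \<comment> \<open>The cutoff \<open>Suc n\<close> leaves indices up to \<open>n\<close> once the
    constant term is split off and the index shifted.\<close>
  have "(const_coeffs L oo H) $ n = (\<Sum>i\<le>Suc n. fps_const (L $ i) * (H ^ i) $ n)"
    using compose_mult_nth[OF assms, of n "Suc n" "const_coeffs L" 1] by simp
  then have "euler_diff (const_coeffs L oo H) $ n $ a
     = (\<Sum>i\<le>Suc n. L $ i * euler_diff (H ^ i) $ n $ a)"
    by (simp add: euler_diff_nth fps_sum_nth sum_distrib_left mult_ac distrib_left)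
  also have "\<dots> = L $ 0 * euler_diff (H ^ 0) $ n $ a
      + (\<Sum>i\<le>n. L $ Suc i * euler_diff (H ^ Suc i) $ n $ a)"
    by (rule sum.atMost_Suc_shift)
  also have "\<dots> = (\<Sum>i\<le>n. fps_deriv (const_coeffs L) $ i * (H ^ i * euler_diff H) $ n) $ a"
  proof -
    have "L $ Suc i * euler_diff (H ^ Suc i) $ n $ a
        = (fps_deriv (const_coeffs L) $ i * (H ^ i * euler_diff H) $ n) $ a" for i
    proof -
      have "euler_diff (H ^ Suc i) = fps_const (fps_const (of_nat (Suc i))) * (H ^ i * euler_diff H)"
        unfolding euler_diff_power by (simp add: fps_of_nat mult.assoc del: of_nat_Suc)
      moreover have "fps_deriv (const_coeffs L) $ i = fps_const (of_nat (Suc i) * L $ Suc i)"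
        by (simp add: fps_of_nat[symmetric] del: of_nat_Suc)
      ultimately show ?thesis by (simp del: of_nat_Suc fps_deriv_nth power_Suc)
    qed
    moreover have "euler_diff (H ^ 0) $ n $ a = 0"
      by (simp add: euler_diff_nth)
    ultimately show ?thesis by (simp add: fps_sum_nth del: fps_deriv_nth power_Suc)
  qed
  also have "\<dots> = ((fps_deriv (const_coeffs L) oo H) * euler_diff H) $ n $ a"
    using compose_mult_nth[OF assms order_refl] by metis
  finally show "euler_diff (const_coeffs L oo H) $ n $ a
     = ((fps_deriv (const_coeffs L) oo H) * euler_diff H) $ n $ a" .
qed

subsection \<open>Existence and uniqueness of the solution\<close>

lemma is_solution_rhs_nth:
  "(t_var + k_var * subst2 L H) $ n $ a
    = (case a of 0 \<Rightarrow> if n = 1 then 1 else 0 | Suc b \<Rightarrow> subst2 L H $ n $ b)"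
  by (auto split: nat.split)

lemma is_solution_nth:
  assumes "is_solution L H"
  shows "H $ n $ a = (case a of 0 \<Rightarrow> if n = 1 then 1 else 0 | Suc b \<Rightarrow> subst2 L H $ n $ b)"
  using assms is_solution_rhs_nth[of L H n a] unfolding is_solution_def by auto

text \<open>Exponents of \<open>k\<close> add up under multiplication, so none above
  \<open>a\<close> can contribute. With the extra factor \<open>k\<close> in the equation, this
  makes the right-hand side a contraction in powers of \<open>k\<close>.\<close>

lemma power_nth_nth_cong:
  fixes A B :: "'a::field_char_0 fps fps"
  assumes "\<And>n a. a \<le> N \<Longrightarrow> A $ n $ a = B $ n $ a" "a \<le> N"
  shows "(A ^ i) $ n $ a = (B ^ i) $ n $ a"
  using assms(2)
proof (induction i arbitrary: n a)
  case 0
  show ?case by simp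
next
  case (Suc i)
  then show ?case unfolding power_Suc fps_fps_mult_nth_nth
    by (intro sum.cong refl arg_cong2[where f = "(*)"] assms(1)) auto
qed

lemma is_solution_unique:
  assumes "is_solution L A" "is_solution L B"
  shows "A = B"
proof -
  have "A $ n $ a = B $ n $ a" if "a \<le> N" for N n a
    using that
  proof (induction N arbitrary: n a)
    case 0
    then show ?case using is_solution_nth[OF assms(1), of n a] is_solution_nth[OF assms(2), of n a] by simp
  next
    case (Suc N)
    show ?case
    proof (cases a)
      case 0
      then show ?thesis using is_solution_nth[OF assms(1), of n a] is_solution_nth[OF assms(2), of n a] by simp
    next
      case (Suc b)
      then have "b \<le> N" using Suc.prems by simp
      then have "subst2 L A $ n $ b = subst2 L B $ n $ b"
        unfolding subst2_nth using power_nth_nth_cong[OF Suc.IH] by (intro sum.cong) auto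
      then show ?thesis using Suc is_solution_nth[OF assms(1), of n a] is_solution_nth[OF assms(2), of n a] by simp
    qed
  qed
  then show ?thesis by (intro fps_ext) blast
qed

text \<open>Iterating the right-hand side from 0 settles at least one further power of
  \<open>k\<close> each time; the limit is a fixed point.\<close>

lemma is_solution_exists: "\<exists>H. is_solution L H"
proof -
  define step where "step H = t_var + k_var * subst2 L H" for H
  define X where "X N = (step ^^ N) 0" for N
  have step_cong: "step A $ n $ a = step B $ n $ a"
    if "\<And>n a. a < N \<Longrightarrow> A $ n $ a = B $ n $ a" "a \<le> N" for A B N n a
  proof (cases a)
    case 0
    then show ?thesis unfolding step_def is_solution_rhs_nth by simp
  next
    case (Suc b)
    have "(A ^ i) $ n $ b = (B ^ i) $ n $ b" for i
      by (rule power_nth_nth_cong[of b]) (use Suc that in auto)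
    then show ?thesis unfolding step_def is_solution_rhs_nth subst2_nth by (simp add: Suc)
  qed
  have X_Suc: "X (Suc N) = step (X N)" for N by (simp add: X_def)
  have stable: "X (Suc N) $ n $ a = X N $ n $ a" if "a < N" for N n a
    using that
  proof (induction N arbitrary: n a)
    case (Suc N)
    then show ?case unfolding X_Suc[of "Suc N"] X_Suc[of N]
      by (intro step_cong[of N]) (use Suc in \<open>auto simp: X_Suc\<close>)
  qed simp
  \<comment> \<open>By \<open>stable\<close>, the coefficients of \<open>k^a\<close> do not change
    from the iterate \<open>Suc a\<close> on.\<close>
  define H where "H = Abs_fps (\<lambda>n. Abs_fps (\<lambda>a. X (Suc a) $ n $ a))"
  have H: "H $ n $ a = X N $ n $ a" if "a < N" for n a N
    using that
  proof (induction N)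
    case (Suc N)
    then show ?case by (cases "a < N") (auto simp: stable H_def less_Suc_eq)
  qed simp
  have "H $ n $ a = step H $ n $ a" for n a
  proof -
    have "step H $ n $ a = step (X a) $ n $ a" by (rule step_cong[of a]) (auto simp: H)
    then show ?thesis by (simp add: H[of a "Suc a"] X_Suc)
  qed
  then have fixed: "H = step H" by (intro fps_ext)
  have "H $ 0 $ 0 = 0"
    by (subst fixed) (simp add: step_def)
  with fixed show ?thesis unfolding is_solution_def step_def by blast
qed

subsection \<open>Diagonals of the solution\<close>

text \<open>Induction on the power of \<open>k\<close>: only \<open>i \<ge> 2\<close> occurs in
  \<open>L\<close>, so \<open>L(H)\<close> has weight at least 2, and the factor \<open>k\<close>
  lowers it by one.\<close>

lemma is_solution_weight:
  assumes "is_solution L H" "L $ 0 = 0" "L $ 1 = 0"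
  shows "weight_ge N 1 H"
proof (induction N)
  case 0
  show ?case using is_solution_nth[OF assms(1), of _ 0] by (simp add: weight_ge_def)
next
  case (Suc N)
  have "H $ n $ Suc N = 0" if "n < Suc N + 1" for n
  proof -
    have "L $ i * (H ^ i) $ n $ N = 0" for i
    proof -
      consider "i = 0" | "i = 1" | "i \<ge> 2" by linarith
      then show ?thesis
        using assms(2,3) weight_geD[OF weight_ge_power[OF Suc, of i], of N n] that by cases auto
    qed
    then have "subst2 L H $ n $ N = 0" unfolding subst2_nth by (intro sum.neutral) blast
    then show ?thesis by (simp add: is_solution_nth[OF assms(1)])
  qed
  with Suc show ?case by (auto simp: weight_ge_def le_Suc_eq)
qed

lemma is_solution_nth_0:
  assumes "is_solution L H" "L $ 0 = 0" "L $ 1 = 0"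
  shows "H $ 0 = 0"
  using weight_geD[OF is_solution_weight[OF assms] order_refl] by (intro fps_ext) simp

text \<open>The series \<open>k H^i\<close> has gap at least \<open>i - 1\<close>, so only
  \<open>t\<close> and the quadratic term reach gap 1.\<close>

lemma is_solution_diagonal_eq:
  assumes "is_solution L H" "L $ 0 = 0" "L $ 1 = 0"
  shows "diagonal 1 H = fps_X + fps_const (L $ 2) * diagonal 1 H ^ 2"
proof (rule fps_ext)
  fix n :: nat
  note weight = is_solution_weight[OF assms]
  have sq: "diagonal 1 H ^ 2 = diagonal 2 (H ^ 2)" by (rule diagonal_power[symmetric]) (rule weight)
  consider "n = 0" | "n = 1" | b where "n = b + 2"
  proof -
    have "n = 0 \<or> n = 1 \<or> n = (n - 2) + 2" by linarith
    then show ?thesis using that by blast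
  qed
  then show "diagonal 1 H $ n = (fps_X + fps_const (L $ 2) * diagonal 1 H ^ 2) $ n"
  proof cases
    case 3
    have "L $ i * (H ^ i) $ n $ b = 0" if "i \<noteq> 2" for i
    proof -
      consider "i = 0" | "i = 1" | "i > 2" using \<open>i \<noteq> 2\<close> by linarith
      then show ?thesis
        using assms(2,3) weight_geD[OF weight_ge_power[OF weight, of b i] order_refl, of n] 3
        by cases auto
    qed
    then have "subst2 L H $ n $ b = (\<Sum>i\<in>{2}. L $ i * (H ^ i) $ n $ b)"
      unfolding subst2_nth using 3 by (intro sum.mono_neutral_right) auto
    then show ?thesis
      unfolding sq using 3 by (simp add: diagonal_nth is_solution_nth[OF assms(1)])
  qed (unfold sq, simp_all add: diagonal_nth is_solution_nth[OF assms(1)])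
qed

lemma is_solution_diagonal:
  assumes "is_solution L H" "L $ 0 = 0" "L $ 1 = 0" "L $ 2 \<noteq> 0"
  shows "diagonal 1 H = fps_const (1 / (2 * L $ 2)) + fps_const (- 1 / (2 * L $ 2)) * sqrt_1_minus_4 (L $ 2)"
proof -
  define v S c where "v = diagonal 1 H" and "S = sqrt_1_minus_4 (L $ 2)" and "c = L $ 2"
  have v: "v = fps_X + fps_const c * v ^ 2"
    using is_solution_diagonal_eq[OF assms(1-3)] by (simp add: v_def c_def)
  \<comment> \<open>Completing the square in \<open>v = t + c v^2\<close> gives
    \<open>A^2 = 1 - 4ct\<close>.\<close>
  define A where "A = 1 - fps_const (2 * c) * v"
  have "A ^ 2 = 1 - fps_const (4 * c) * (v - fps_const c * v ^ 2)"
    by (simp add: A_def power2_eq_square algebra_simps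
        flip: fps_const_mult fps_const_add numeral_fps_const)
  also have "v - fps_const c * v ^ 2 = fps_X" using v by (simp add: algebra_simps)
  also have "1 - fps_const (4 * c) * fps_X = S ^ 2"
    by (simp add: S_def c_def sqrt_1_minus_4_power2)
  finally have "(A - S) * (A + S) = 0" by (simp add: power2_eq_square algebra_simps)
  \<comment> \<open>The constant term excludes the other root \<open>A = -S\<close>.\<close>
  moreover have "(A + S) $ 0 = 2"
    by (simp add: A_def S_def sqrt_1_minus_4_nth_0 v_def diagonal_nth)
  then have "A + S \<noteq> 0" by (metis fps_zero_nth zero_neq_numeral)
  ultimately have "A = S" by simp
  then have "fps_const (2 * c) * v = 1 - S" by (simp add: A_def algebra_simps)
  then have "fps_const (1 / (2 * c)) * (fps_const (2 * c) * v) = fps_const (1 / (2 * c)) * (1 - S)"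
    by simp
  moreover have "fps_const (1 / (2 * c)) * (fps_const (2 * c) * v) = v"
    using assms(4) by (simp add: c_def flip: mult.assoc)
  ultimately have "v = fps_const (1 / (2 * c)) - fps_const (1 / (2 * c)) * S"
    by (metis mult.right_neutral right_diff_distrib)
  also have "\<dots> = fps_const (1 / (2 * c)) + fps_const (- 1 / (2 * c)) * S"
    by (metis add_uminus_conv_diff fps_const_neg minus_divide_left mult_minus_left)
  finally have "v = fps_const (1 / (2 * c)) + fps_const (- 1 / (2 * c)) * S" .
  then show ?thesis unfolding v_def S_def c_def .
qed

section \<open>Differential equation for the powers of \<open>H\<close> and recursion for their
  diagonals\<close>

lemma power_mult_deriv_nth_nth:
  fixes H :: "'a::field_char_0 fps fps"
  assumes "p > 0"
  shows "(H ^ (p - 1) * fps_deriv H) $ n $ a = of_nat (n + 1) / of_nat p * (H ^ p) $ (n + 1) $ a"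
proof -
  have "fps_deriv (H ^ p) = fps_const (fps_const (of_nat p)) * (H ^ (p - 1) * fps_deriv H)"
    unfolding fps_deriv_power' by (simp add: fps_of_nat mult_ac)
  then have "fps_deriv (H ^ p) $ n $ a = of_nat p * (H ^ (p - 1) * fps_deriv H) $ n $ a"
    by simp
  moreover have "fps_deriv (H ^ p) $ n $ a = of_nat (n + 1) * (H ^ p) $ (n + 1) $ a"
  proof -
    have "fps_deriv (H ^ p) $ n = fps_const (of_nat (n + 1)) * (H ^ p) $ (n + 1)"
      by (simp add: fps_of_nat del: of_nat_Suc of_nat_add)
    then show ?thesis by (simp del: fps_deriv_nth)
  qed
  ultimately show ?thesis using assms by (simp add: field_simps)
qed

text \<open>Applying both derivations to \<open>H = t + kC\<close> gives
  \<open>(1 - kU) H' = 1\<close> and \<open>(1 - kU) E H = t - kC\<close>, where \<open>E\<close> is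
  \<open>euler_diff\<close> and \<open>H'\<close> the derivative in \<open>t\<close>. Hence
  \<open>E H = (t - kC) H'\<close>, and the power rule passes to \<open>H ^ Suc j\<close>.\<close>

lemma is_solution_pde:
  fixes H :: "'a::field_char_0 fps fps"
  assumes sol: "is_solution L H" and L: "L $ 0 = 0" "L $ 1 = 0"
  shows "euler_diff (H ^ Suc j) - of_nat (Suc j) * H ^ Suc j
    = k_var * (of_nat (Suc j) * ((const_coeffs (Abs_fps (\<lambda>i. (of_nat i - 2) * L $ i)) oo H)
        * (H ^ j * fps_deriv H)))"
proof -
  note H0 = is_solution_nth_0[OF assms]
  define C U where "C = const_coeffs L oo H" and "U = fps_deriv (const_coeffs L) oo H"
  have H: "H = t_var + k_var * C"
    using sol subst2_eq_fps_compose[OF H0] by (simp add: is_solution_def C_def)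
  have dH: "fps_deriv H = 1 + k_var * (U * fps_deriv H)"
  proof -
    have "fps_deriv H = 1 + k_var * fps_deriv C" by (subst H) simp
    then show ?thesis by (simp add: C_def U_def fps_compose_deriv[OF H0])
  qed
  have eH: "euler_diff H = t_var - k_var * C + k_var * (U * euler_diff H)"
  proof -
    have "euler_diff H = t_var - k_var * C + k_var * euler_diff C"
      by (subst H) (simp add: euler_diff_add euler_diff_mult euler_diff_t_var euler_diff_k_var
          del: fps_const_neg)
    then show ?thesis by (simp add: C_def U_def euler_diff_compose[OF H0])
  qed
  have "(1 - k_var * U) * (euler_diff H - (t_var - k_var * C) * fps_deriv H) = 0"
  proof -
    have "(1 - k_var * U) * euler_diff H = t_var - k_var * C" using eH by (simp add: algebra_simps)
    moreover have "(1 - k_var * U) * fps_deriv H = 1" using dH by (simp add: algebra_simps)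
    moreover have "(1 - k_var * U) * (euler_diff H - (t_var - k_var * C) * fps_deriv H)
        = (1 - k_var * U) * euler_diff H - (t_var - k_var * C) * ((1 - k_var * U) * fps_deriv H)"
      by (simp only: right_diff_distrib mult.left_commute)
    ultimately show ?thesis by simp
  qed
  moreover have "(1 - k_var * U) $ 0 $ 0 = 1" by simp
  then have "1 - k_var * U \<noteq> 0" by (metis fps_zero_nth zero_neq_one)
  ultimately have eH': "euler_diff H = (t_var - k_var * C) * fps_deriv H" by simp
  \<comment> \<open>The factor \<open>i - 2\<close> comes from \<open>x L'(x) - 2 L(x)\<close>; it
    will remove the quadratic term from the recursion.\<close>
  have PH: "const_coeffs (Abs_fps (\<lambda>i. (of_nat i - 2) * L $ i)) oo H = H * U - 2 * C"
  proof -
    have "const_coeffs (Abs_fps (\<lambda>i. (of_nat i - 2) * L $ i))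
       = fps_X * fps_deriv (const_coeffs L) - fps_const (fps_const 2) * const_coeffs L"
      by (intro fps_ext) (simp add: algebra_simps fps_of_nat[symmetric] numeral_fps_const)
    also have "\<dots> oo H = H * U - fps_const (fps_const 2) * C"
      by (simp add: fps_compose_sub_distrib fps_compose_mult_distrib[OF H0] H0 U_def C_def)
    finally show ?thesis by (simp add: numeral_fps_const)
  qed
  have "euler_diff H - H = k_var * (H * U - 2 * C) * fps_deriv H"
  proof -
    have "euler_diff H - H = (H - 2 * (k_var * C)) * fps_deriv H - H"
      unfolding eH' using H by (simp add: algebra_simps)
    also have "\<dots> = H * (fps_deriv H - 1) - 2 * (k_var * C) * fps_deriv H"
      by (simp add: algebra_simps)
    also have "fps_deriv H - 1 = k_var * (U * fps_deriv H)"
      using dH by (simp add: algebra_simps)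
    finally show ?thesis by (simp add: algebra_simps)
  qed
  moreover have "euler_diff (H ^ Suc j) - of_nat (Suc j) * H ^ Suc j
     = of_nat (Suc j) * H ^ j * (euler_diff H - H)"
    unfolding euler_diff_power by (simp add: algebra_simps)
  ultimately show ?thesis unfolding PH by (simp add: mult_ac)
qed

text \<open>Compares coefficients with gap \<open>j + m\<close> in the differential equation. The
  index \<open>i + j + (m + 2 - i)\<close> is just \<open>m + j + 2\<close>, written so that each
  summand has the form \<open>F_(i+j, m+2-i)\<close> with \<open>m + 2 - i < m\<close>.\<close>

lemma is_solution_diagonal_rec:
  fixes H :: "'a::field_char_0 fps fps"
  assumes sol: "is_solution L H" and L: "L $ 0 = 0" "L $ 1 = 0" and j: "j > 0"
  shows "fps_const (of_nat m) * diagonal (j + m) (H ^ j) = fps_deriv (\<Sum>i=3..m + 2.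
      fps_const ((of_nat i - 2) * L $ i * of_nat j / of_nat (i + j)) *
        diagonal (i + j + (m + 2 - i)) (H ^ (i + j)))"
    (is "_ = fps_deriv ?R")
proof (rule fps_ext)
  fix n
  note H0 = is_solution_nth_0[OF sol L] and weight = is_solution_weight[OF sol L]
  let ?c = "\<lambda>i. (of_nat i - 2) * L $ i * of_nat j / of_nat (i + j)"
  have R: "fps_deriv ?R $ n = of_nat (n + 1) *
      (\<Sum>i=3..m + 2. ?c i * diagonal (m + j + 2) (H ^ (i + j)) $ (n + 1))"
    by (simp add: fps_sum_nth add_ac)
  show "(fps_const (of_nat m) * diagonal (j + m) (H ^ j)) $ n = fps_deriv ?R $ n"
  proof (cases "j + m \<le> n")
    case False
    then show ?thesis unfolding R by (simp add: diagonal_nth)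
  next
    case True
    define a where "a = n - (j + m)"
    have a: "of_nat n - of_nat a - of_nat j = (of_nat m :: 'a)"
      using True by (simp add: a_def of_nat_diff)
    let ?P = "const_coeffs (Abs_fps (\<lambda>i. (of_nat i - 2) * L $ i))"
    let ?Q = "(?P oo H) * (H ^ (j - 1) * fps_deriv H)"
    have "euler_diff (H ^ j) - fps_const (fps_const (of_nat j)) * H ^ j
       = k_var * (fps_const (fps_const (of_nat j)) * ?Q)"
      using is_solution_pde[OF sol L, of "j - 1"] j by (simp add: fps_of_nat)
    then have "(euler_diff (H ^ j) - fps_const (fps_const (of_nat j)) * H ^ j) $ n $ a
       = (k_var * (fps_const (fps_const (of_nat j)) * ?Q)) $ n $ a" by (rule arg_cong)
    also have "\<dots> = (if a = 0 then 0 else of_nat j * ?Q $ n $ (a - 1))"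
      unfolding fps_mult_left_const_nth fps_X_mult_nth by simp
    also have "(euler_diff (H ^ j) - fps_const (fps_const (of_nat j)) * H ^ j) $ n $ a
       = of_nat m * (H ^ j) $ n $ a"
      by (simp add: euler_diff_nth a[symmetric] algebra_simps)
    finally have main: "of_nat m * (H ^ j) $ n $ a = (if a = 0 then 0 else of_nat j * ?Q $ n $ (a - 1))" .
    show ?thesis
    proof (cases "a = 0")
      case True
      \<comment> \<open>Now \<open>n + 1 = j + m + 1\<close> lies below \<open>m + j + 2\<close>, so
        all diagonals on the right vanish there.\<close>
      then show ?thesis unfolding R using main \<open>j + m \<le> n\<close>
        by (simp add: diagonal_nth a_def)
    next
      case False
      \<comment> \<open>Large enough both to truncate the composition at order \<open>n\<close> and
        to include all \<open>i \<le> m + 2\<close>.\<close>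
      let ?N = "n + m + 2"
      have Q: "?Q $ n $ (a - 1) = (\<Sum>i\<le>?N. (of_nat i - 2) * L $ i *
          (H ^ i * (H ^ (j - 1) * fps_deriv H)) $ n $ (a - 1))"
        by (subst compose_mult_nth[OF H0, of n ?N]) (simp_all add: fps_sum_nth)
      have jQ: "of_nat j * (\<Sum>i\<le>?N. (of_nat i - 2) * L $ i *
          (H ^ i * (H ^ (j - 1) * fps_deriv H)) $ n $ (a - 1))
        = of_nat (n + 1) * (\<Sum>i\<le>?N. ?c i * (H ^ (i + j)) $ (n + 1) $ (a - 1))"
        unfolding sum_distrib_left
      proof (intro sum.cong refl)
        fix i
        have "i + j - 1 = i + (j - 1)" using j by simp
        then have "H ^ i * (H ^ (j - 1) * fps_deriv H) = H ^ (i + j - 1) * fps_deriv H"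
          by (simp only: power_add mult.assoc)
        moreover have "i + j > 0" using j by simp
        ultimately have "(H ^ i * (H ^ (j - 1) * fps_deriv H)) $ n $ (a - 1)
          = of_nat (n + 1) / of_nat (i + j) * (H ^ (i + j)) $ (n + 1) $ (a - 1)"
          by (simp only: power_mult_deriv_nth_nth)
        then show "of_nat j * ((of_nat i - 2) * L $ i *
            (H ^ i * (H ^ (j - 1) * fps_deriv H)) $ n $ (a - 1))
          = of_nat (n + 1) * (?c i * (H ^ (i + j)) $ (n + 1) $ (a - 1))"
          by (simp only: times_divide_eq_left times_divide_eq_right mult_ac)
      qed
      have "(\<Sum>i\<le>?N. ?c i * (H ^ (i + j)) $ (n + 1) $ (a - 1))
        = (\<Sum>i=3..m + 2. ?c i * (H ^ (i + j)) $ (n + 1) $ (a - 1))"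
      proof (rule sum.mono_neutral_right)
        show "\<forall>i\<in>{..?N} - {3..m + 2}. ?c i * (H ^ (i + j)) $ (n + 1) $ (a - 1) = 0"
        proof
          fix i assume "i \<in> {..?N} - {3..m + 2}"
          then have "i < 3 \<or> i > m + 2" by auto
          then consider "i = 0" | "i = 1" | "i = 2" | "i > m + 2" by linarith
          then show "?c i * (H ^ (i + j)) $ (n + 1) $ (a - 1) = 0"
          proof cases
            case 4
            \<comment> \<open>Beyond \<open>m + 2\<close> the weight of \<open>H ^ (i + j)\<close>
              exceeds the available gap \<open>m + j + 2\<close>.\<close>
            then have "n + 1 < a - 1 + (i + j)" using \<open>j + m \<le> n\<close> False by (simp add: a_def)
            then show ?thesis
              by (simp add: weight_geD[OF weight_ge_power[OF weight] order_refl])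
          qed (use L in auto)
        qed
      qed auto
      also have "\<dots> = (\<Sum>i=3..m + 2. ?c i * diagonal (m + j + 2) (H ^ (i + j)) $ (n + 1))"
      proof -
        have "m + j + 2 \<le> n + 1" "n + 1 - (m + j + 2) = a - 1"
          using False by (auto simp: a_def)
        then show ?thesis by (simp add: diagonal_nth)
      qed
      finally have diag: "(\<Sum>i\<le>?N. ?c i * (H ^ (i + j)) $ (n + 1) $ (a - 1))
        = (\<Sum>i=3..m + 2. ?c i * diagonal (m + j + 2) (H ^ (i + j)) $ (n + 1))" .
      have "(fps_const (of_nat m) * diagonal (j + m) (H ^ j)) $ n = of_nat m * (H ^ j) $ n $ a"
        using True by (simp add: diagonal_nth a_def)
      also have "\<dots> = of_nat j * ?Q $ n $ (a - 1)"
        using main False by simp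
      finally show ?thesis unfolding R Q jQ diag .
    qed
  qed
qed

text \<open>Strong induction on \<open>m\<close>, with \<open>j\<close> arbitrary because the
  recursion raises the power of \<open>H\<close>. For \<open>m > 0\<close>, dividing by
  \<open>m\<close> is legitimate in characteristic 0.\<close>

lemma laurent_poly_no_even_neg_diagonal:
  assumes "is_solution L H" "L $ 0 = 0" "L $ 1 = 0" "L $ 2 \<noteq> 0" "j > 0"
  shows "laurent_poly_no_even_neg (sqrt_1_minus_4 (L $ 2)) (diagonal (j + m) (H ^ j))"
  using assms(5)
proof (induction m arbitrary: j rule: less_induct)
  case (less m)
  show ?case
  proof (cases "m = 0")
    case True
    then show ?thesis
      using diagonal_power[of H j] is_solution_weight[OF assms(1-3)]
        is_solution_diagonal[OF assms(1-4)] laurent_poly_no_even_neg_linear_power by simp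
  next
    case False
    let ?G = "fps_const (of_nat m) * diagonal (j + m) (H ^ j)"
    have "laurent_poly_no_even_neg (sqrt_1_minus_4 (L $ 2)) ?G"
      unfolding is_solution_diagonal_rec[OF assms(1-3) less.prems]
      by (intro laurent_poly_no_even_neg_deriv laurent_poly_no_even_neg_closed_sum
          laurent_poly_no_even_neg_cmult less.IH) auto
    then have "laurent_poly_no_even_neg (sqrt_1_minus_4 (L $ 2)) (fps_const (1 / of_nat m) * ?G)"
      by (rule laurent_poly_no_even_neg_cmult)
    then show ?thesis using False by (simp flip: mult.assoc)
  qed
qed

section \<open>Degrees in \<open>k\<close>, initial coefficients and the generating series of
  \<open>mu\<close>\<close>

lemma is_solution_degree:
  fixes H :: "'a::field_char_0 fps fps"
  assumes "is_solution L H" "L $ 0 = 0" "L $ 1 = 0" "L $ 2 \<noteq> 0" "n \<ge> 1"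
  shows "\<exists>p. H $ n = fps_of_poly p \<and> degree p = n - 1"
proof (intro exI conjI)
  note weight = weight_geD[OF is_solution_weight[OF assms(1-3)] order_refl]
  \<comment> \<open>Nothing is cut off: weight 1 kills every coefficient from \<open>k^n\<close>
    on.\<close>
  let ?p = "truncate_fps n (H $ n)"
  show Hp: "H $ n = fps_of_poly ?p"
    using weight by (intro fps_ext) (auto simp: fps_of_poly_truncate)
  \<comment> \<open>The leading coefficient is a nonzero multiple of the coefficient of
    \<open>t^n\<close> in the square root.\<close>
  have "H $ n $ (n - 1) = diagonal 1 H $ n" using assms(5) by (simp add: diagonal_nth)
  also have "\<dots> \<noteq> 0"
    unfolding is_solution_diagonal[OF assms(1-4)]
    using sqrt_1_minus_4_nth_nonzero[OF assms(4), of n] assms(4,5) by simp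
  finally have "coeff ?p (n - 1) \<noteq> 0" using Hp by (metis fps_of_poly_nth)
  moreover have "coeff ?p i = 0" if "i > n - 1" for i
  proof -
    have "H $ n $ i = 0" using weight[of n i] that by simp
    then show ?thesis using Hp by (metis fps_of_poly_nth)
  qed
  ultimately show "degree ?p = n - 1"
    by (intro antisym degree_le le_degree) auto
qed

theorem theorem6:
  fixes \<Lambda> :: "'a::field_char_0 fps"
  assumes "\<Lambda> $ 0 = 0" and "\<Lambda> $ 1 = 0" and "\<Lambda> $ 2 \<noteq> 0"
  shows "(\<exists>!H. is_solution \<Lambda> H) \<and>
    (\<forall>H. is_solution \<Lambda> H \<longrightarrow>
       H $ 0 = 0 \<and>
       H $ 1 = 1 \<and>
       H $ 2 = fps_const (\<Lambda> $ 2) * fps_X \<and>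
       H $ 3 = fps_const (\<Lambda> $ 3) * fps_X + fps_const (2 * (\<Lambda> $ 2)^2) * fps_X^2 \<and>
       (\<forall>n\<ge>1. \<exists>p :: 'a poly. H $ n = fps_of_poly p \<and> degree p = n - 1) \<and>
       (\<forall>l :: int. laurent_poly_no_even_neg (sqrt_1_minus_4 (\<Lambda> $ 2))
          (Abs_fps (\<lambda>n. mu H l n / fact n))))"
proof (intro conjI allI impI)
  show "\<exists>!H. is_solution \<Lambda> H"
    using is_solution_exists is_solution_unique by blast
next
  fix H assume sol: "is_solution \<Lambda> H"
  note H0 = is_solution_nth_0[OF sol assms(1,2)]
  have rec: "H $ n = t_var $ n + fps_X * (\<Sum>i=0..n. fps_const (\<Lambda> $ i) * (H ^ i) $ n)" for n
  proof -
    have "H = t_var + k_var * (const_coeffs \<Lambda> oo H)"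
      using sol subst2_eq_fps_compose[OF H0] by (simp add: is_solution_def)
    then have "H $ n = (t_var + k_var * (const_coeffs \<Lambda> oo H)) $ n" by simp
    then show ?thesis by (simp add: fps_compose_nth)
  qed
  show "H $ 0 = 0" by (rule H0)
  show H1: "H $ 1 = 1" using rec[of 1] assms(1,2) by simp
  show H2: "H $ 2 = fps_const (\<Lambda> $ 2) * fps_X"
    using rec[of 2] assms(1,2) H0 H1
    by (simp add: numeral_2_eq_2 fps_mult_nth mult.commute)
  show "H $ 3 = fps_const (\<Lambda> $ 3) * fps_X + fps_const (2 * (\<Lambda> $ 2)^2) * fps_X^2"
  proof -
    have "(H ^ 2) $ 3 = 2 * H $ 2" "(H ^ 3) $ 3 = 1"
      using H0 H1 by (simp_all add: eval_nat_numeral fps_mult_nth)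
    then have "H $ 3 = fps_X * (fps_const (\<Lambda> $ 2) * (2 * (fps_const (\<Lambda> $ 2) * fps_X)) + fps_const (\<Lambda> $ 3))"
      using rec[of 3] assms(1,2) H2 by (simp add: eval_nat_numeral)
    then show ?thesis
      by (simp add: power2_eq_square algebra_simps numeral_fps_const flip: fps_const_mult)
  qed
  show "\<exists>p :: 'a poly. H $ n = fps_of_poly p \<and> degree p = n - 1" if "n \<ge> 1" for n
    by (rule is_solution_degree[OF sol assms that])
  show "laurent_poly_no_even_neg (sqrt_1_minus_4 (\<Lambda> $ 2)) (Abs_fps (\<lambda>n. mu H l n / fact n))" for l
  proof (cases "l \<le> 0")
    case True
    \<comment> \<open>For \<open>l \<le> 0\<close> the exponent of \<open>k\<close> is at least
      \<open>n\<close>, beyond the weight bound.\<close>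
    have "H $ n $ nat (int n - l) = 0" for n
      using True weight_geD[OF is_solution_weight[OF sol assms(1,2)] order_refl, of n "nat (int n - l)"]
      by simp
    then have "Abs_fps (\<lambda>n. mu H l n / fact n) = 0"
      by (intro fps_ext) (simp add: mu_def)
    then show ?thesis by (simp add: laurent_poly_no_even_neg_0)
  next
    case False
    \<comment> \<open>For \<open>l \<ge> 1\<close> the series is \<open>F_(1,m)\<close>, whose gap
      \<open>1 + m\<close> equals \<open>l\<close>.\<close>
    define m where "m = nat (l - 1)"
    have l: "l = int (1 + m)" using False by (simp add: m_def)
    have "Abs_fps (\<lambda>n. mu H l n / fact n) = diagonal (1 + m) (H ^ 1)"
    proof (rule fps_ext)
      fix n
      have "nat (int n - l) = n - (1 + m)" "l \<le> int n \<longleftrightarrow> 1 + m \<le> n" using l by linarith+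
      then show "Abs_fps (\<lambda>n. mu H l n / fact n) $ n = diagonal (1 + m) (H ^ 1) $ n"
        by (simp add: mu_def diagonal_nth)
    qed
    then show ?thesis
      using laurent_poly_no_even_neg_diagonal[OF sol assms, of 1 m] by simp
  qed
qed

end
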